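(* Let $p>1$ and suppose the standing assumptions (1)-(6) of the context hold. For $f_n:\Omega_n\to\mathbb{R}$ and $\varepsilon>0$ define $\mathrm{osc}_\varepsilon^{(n)}(f_n):\Omega_n\to\mathbb{R}$ by $$\mathrm{osc}_\varepsilon^{(n)}(f_n)(x_i)=\max_{z\in B(x_i,\varepsilon)\cap\Omega_n}f_n(z)-\min_{z\in B(x_i,\varepsilon)\cap\Omega_n}f_n(z).$$ For any $\alpha_0>0$, with probability one, there exist $n_0>0$ and $C>0$ (independent of $n$) such that for any $\alpha\ge\alpha_0$, all $n\ge n_0$, all $f_n:\Omega_n\to\mathbb{R}$, and all $k\in\{1,\dots,n\}$, $$\left(\mathrm{osc}_{\alpha\varepsilon_n}^{(n)}(f_n)(x_k)\right)^p\le C\,\alpha^p\,n\,\varepsilon_n^p\,\mathcal{E}_n^{(p)}(f_n).$$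
   Context: Standing assumptions. (1) $\Omega\subset\mathbb{R}^d$ ($d\ge1$) is open, connected, bounded, with Lipschitz boundary. (2) $\mu$ is a probability measure on $\Omega$ with a continuous density $\rho$ (with respect to Lebesgue measure) that is bounded above and below by strictly positive constants in $\Omega$. (3) $N\ge1$ is fixed and $(x_i,y_i)\in\Omega\times\mathbb{R}$, $i=1,\dots,N$, are labeled points, with the $x_i$ distinct. (4) For $i>N$ the points $x_i$ are iid samples of $\mu$; "with probability one" refers to this sample. (5) $\varepsilon_n>0$, $\varepsilon_n\to0$, and $\varepsilon_n/\ell_n\to\infty$, where $\ell_n=\sqrt{\log\log n/n}$ if $d=1$, $\ell_n=(\log n)^{3/4}/\sqrt{n}$ if $d=2$, $\ell_n=(\log n/n)^{1/d}$ if $d\ge3$. (6) $\eta:[0,\infty)\to[0,\infty)$ is non-increasing, is positive and continuous at $0$, and $\sigma_\eta:=\int_{\mathbb{R}^d}\eta(|w|)\,|w\cdot e_1|^p\,dw<\infty$, where $e_1=(1,0,\dots,0)$. Notation. $\Omega_n=\{x_1,\dots,x_n\}$, $\eta_\varepsilon(t)=\varepsilon^{-d}\eta(t/\varepsilon)$, $W_{ij}=\eta_{\varepsilon_n}(|x_i-x_j|)$, and for $f:\Omega_n\to\mathbb{R}$, $$\mathcal{E}_n^{(p)}(f)=\frac{1}{\varepsilon_n^p n^2}\sum_{i,j=1}^nW_{ij}|f(x_i)-f(x_j)|^p.$$ $B(x,r)$ is the Euclidean ball of center $x$ and radius $r$. *)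

theory Defs
  imports "HOL-Probability.Probability"
begin

text \<open>Near every boundary point, after a rotation taking the last coordinate direction to the unit
  vector \<open>v\<close>, the domain is the strict epigraph of a Lipschitz function \<open>g\<close> defined on the hyperplane
  orthogonal to \<open>v\<close>.\<close>

definition lipschitz_boundary :: "'a::euclidean_space set \<Rightarrow> bool" where
  "lipschitz_boundary \<Omega> \<longleftrightarrow>
    (\<forall>z\<in>frontier \<Omega>. \<exists>r>0. \<exists>v. norm v = 1 \<and>
      (\<exists>(g :: 'a \<Rightarrow> real) L. L-lipschitz_on {u. u \<bullet> v = 0} g \<and>
        \<Omega> \<inter> ball z r = {u \<in> ball z r. g (u - (u \<bullet> v) *\<^sub>R v) < u \<bullet> v}))"

definition conn_scale :: "nat \<Rightarrow> nat \<Rightarrow> real" where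
  "conn_scale d n =
    (if d = 1 then sqrt (ln (ln (real n)) / real n)
     else if d = 2 then ln (real n) powr (3/4) / sqrt (real n)
     else (ln (real n) / real n) powr (1 / real d))"

definition eta_scaled :: "nat \<Rightarrow> (real \<Rightarrow> real) \<Rightarrow> real \<Rightarrow> real \<Rightarrow> real" where
  "eta_scaled d \<eta> \<epsilon> t = \<eta> (t / \<epsilon>) / \<epsilon> ^ d"

definition sigma_eta :: "(real \<Rightarrow> real) \<Rightarrow> real \<Rightarrow> 'a::euclidean_space \<Rightarrow> ennreal" where
  "sigma_eta \<eta> p e1 = (\<integral>\<^sup>+ w. ennreal (\<eta> (norm w) * \<bar>w \<bullet> e1\<bar> powr p) \<partial>lborel)"

definition sample_set :: "(nat \<Rightarrow> 'a) \<Rightarrow> nat \<Rightarrow> 'a set" where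
  "sample_set x n = x ` {1..n}"

text \<open>Functions on the sample set are represented by total functions \<open>f\<close>; below, only the values
  of \<open>f\<close> at the sample points are used.\<close>

definition graph_energy ::
  "(real \<Rightarrow> real) \<Rightarrow> real \<Rightarrow> real \<Rightarrow> (nat \<Rightarrow> 'a::euclidean_space) \<Rightarrow> nat \<Rightarrow> ('a \<Rightarrow> real) \<Rightarrow> real" where
  "graph_energy \<eta> p \<epsilon> x n f =
    1 / (\<epsilon> powr p * (real n)\<^sup>2) *
    (\<Sum>i=1..n. \<Sum>j=1..n. eta_scaled DIM('a) \<eta> \<epsilon> (norm (x i - x j)) * \<bar>f (x i) - f (x j)\<bar> powr p)"

definition graph_osc ::
  "(nat \<Rightarrow> 'a::euclidean_space) \<Rightarrow> nat \<Rightarrow> real \<Rightarrow> ('a \<Rightarrow> real) \<Rightarrow> 'a \<Rightarrow> real" where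
  "graph_osc x n r f z =
    Max (f ` (ball z r \<inter> sample_set x n)) - Min (f ` (ball z r \<inter> sample_set x n))"

end

theory Submission
  imports Defs "HOL-Real_Asymp.Real_Asymp"
begin

text \<open>A single edge bounds \<open>\<bar>f x\<^sub>i - f x\<^sub>j\<bar>\<^sup>p\<close> only by \<open>n\<^sup>2 \<epsilon>\<^sup>p \<epsilon>\<^sup>d \<E>\<close>. If every ball of radius
  comparable to \<open>\<epsilon>\<close> centred in the domain contains at least \<open>c n \<epsilon>\<^sup>d\<close> samples, averaging over
  the common neighbours of two close points improves this to \<open>C n \<epsilon>\<^sup>p \<E>\<close>. A connected bounded
  Lipschitz domain is quasiconvex, so points at distance \<open>\<alpha> \<epsilon>\<close> are joined by a path in the domain
  of length at most \<open>C \<alpha> \<epsilon>\<close>, hence by a chain of at most \<open>C \<alpha>\<close> hops between samples; the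
  \<open>p\<close>-th power of the number of hops is the factor \<open>\<alpha>\<^sup>p\<close>. The density of samples holds eventually
  almost surely: the hypothesis on \<open>\<epsilon>\<close> forces \<open>n \<epsilon>\<^sup>d / ln n \<rightarrow> \<infinity>\<close> in every dimension, so a
  Chernoff bound over a net of at most \<open>n\<close> balls is summable.\<close>

section \<open>Geometry of Lipschitz domains\<close>

text \<open>The number \<open>l\<close> is only an upper bound for the length of the curve: a
  1-Lipschitz parametrisation may pause. This avoids rectifiable arc length, and equally spaced
  parameters directly give points at controlled distance.\<close>

definition joined :: "'a::euclidean_space set \<Rightarrow> real \<Rightarrow> 'a \<Rightarrow> 'a \<Rightarrow> bool" where
  "joined S l x y \<longleftrightarrow> 0 \<le> l \<and>
    (\<exists>\<gamma>. 1-lipschitz_on {0..l} \<gamma> \<and> \<gamma> 0 = x \<and> \<gamma> l = y \<and> \<gamma> ` {0..l} \<subseteq> S)"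

lemma joined_trans:
  assumes "joined S l x y" "joined S l' y z"
  shows "joined S (l + l') x z"
proof -
  obtain \<gamma> where g: "1-lipschitz_on {0..l} \<gamma>" "\<gamma> 0 = x" "\<gamma> l = y" "\<gamma> ` {0..l} \<subseteq> S" "0 \<le> l"
    using assms(1) unfolding joined_def by blast
  obtain \<gamma>' where g': "1-lipschitz_on {0..l'} \<gamma>'" "\<gamma>' 0 = y" "\<gamma>' l' = z" "\<gamma>' ` {0..l'} \<subseteq> S" "0 \<le> l'"
    using assms(2) unfolding joined_def by blast
  let ?h = "\<lambda>t. if t \<le> l then \<gamma> t else \<gamma>' (t - l)"
  have "1-lipschitz_on {l..l + l'} (\<lambda>t. \<gamma>' (t - l))"
    using g'(1) unfolding lipschitz_on_def dist_real_def
    by (smt (verit) atLeastAtMost_iff)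
  then have "1-lipschitz_on {0..l + l'} ?h"
    by (intro lipschitz_on_concat[OF g(1)]) (simp_all add: g g')
  moreover have "?h 0 = x" "?h (l + l') = z" "?h ` {0..l + l'} \<subseteq> S"
    using g g' by (auto simp: image_subset_iff)
  ultimately show ?thesis
    unfolding joined_def using g(5) g'(5) by (intro conjI exI[of _ ?h]) auto
qed

lemma joined_sym:
  assumes "joined S l x y"
  shows "joined S l y x"
proof -
  obtain \<gamma> where g: "1-lipschitz_on {0..l} \<gamma>" "\<gamma> 0 = x" "\<gamma> l = y" "\<gamma> ` {0..l} \<subseteq> S" "0 \<le> l"
    using assms unfolding joined_def by blast
  have "1-lipschitz_on {0..l} (\<lambda>t. \<gamma> (l - t))"
    using g(1) unfolding lipschitz_on_def dist_real_def
    by (smt (verit) atLeastAtMost_iff)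
  moreover have "(\<lambda>t. \<gamma> (l - t)) ` {0..l} \<subseteq> S"
    using g by (auto simp: image_subset_iff)
  ultimately show ?thesis
    unfolding joined_def using g by (intro conjI exI[of _ "\<lambda>t. \<gamma> (l - t)"]) auto
qed

lemma joined_mono:
  assumes "joined S l x y" "l \<le> l'"
  shows "joined S l' x y"
proof -
  obtain \<gamma> where g: "1-lipschitz_on {0..l} \<gamma>" "\<gamma> 0 = x" "\<gamma> l = y" "\<gamma> ` {0..l} \<subseteq> S" "0 \<le> l"
    using assms(1) unfolding joined_def by blast
  have "1-lipschitz_on {0..l'} (\<lambda>t. \<gamma> (min t l))"
  proof (rule lipschitz_onI)
    fix s t assume st: "s \<in> {0..l'}" "t \<in> {0..l'}"
    have "dist (\<gamma> (min s l)) (\<gamma> (min t l)) \<le> 1 * dist (min s l) (min t l)"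
      by (intro lipschitz_onD[OF g(1)]) (use st g(5) in auto)
    also have "\<dots> \<le> 1 * dist s t" by (auto simp: dist_real_def min_def)
    finally show "dist (\<gamma> (min s l)) (\<gamma> (min t l)) \<le> 1 * dist s t" .
  qed simp
  moreover have "(\<lambda>t. \<gamma> (min t l)) ` {0..l'} \<subseteq> S"
    using g by (auto simp: image_subset_iff)
  ultimately show ?thesis
    unfolding joined_def using g assms(2) by (intro conjI exI[of _ "\<lambda>t. \<gamma> (min t l)"]) auto
qed

lemma joined_segment:
  assumes "closed_segment x y \<subseteq> S"
  shows "joined S (dist x y) x y"
proof -
  \<comment> \<open>For \<open>x = y\<close> the division by zero gives 0 and the map is constantly
    \<open>x\<close>, so no case distinction is required.\<close>
  let ?g = "\<lambda>t. x + (t / dist x y) *\<^sub>R (y - x)"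
  have "1-lipschitz_on {0..dist x y} ?g"
  proof (rule lipschitz_onI)
    fix s t
    have "dist (?g s) (?g t) = norm ((s / dist x y - t / dist x y) *\<^sub>R (y - x))"
      by (simp add: dist_norm algebra_simps)
    also have "\<dots> = \<bar>s - t\<bar> / dist x y * dist x y"
      by (simp add: dist_norm norm_minus_commute flip: diff_divide_distrib)
    also have "\<dots> \<le> 1 * dist s t" by (simp add: dist_real_def)
    finally show "dist (?g s) (?g t) \<le> 1 * dist s t" .
  qed simp
  moreover have "?g ` {0..dist x y} \<subseteq> S"
  proof (intro image_subsetI)
    fix t assume "t \<in> {0..dist x y}"
    then have "?g t \<in> closed_segment x y"
      unfolding in_segment
      by (intro exI[of _ "t / dist x y"]) (auto simp: algebra_simps divide_le_eq_1)
    with assms show "?g t \<in> S" by blast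
  qed
  ultimately show ?thesis
    unfolding joined_def by (intro conjI exI[of _ ?g]) auto
qed

section \<open>Local geometry in one chart\<close>

text \<open>An epigraph is invariant under upward motion along \<open>v\<close>. Lifting two points
  by \<open>L\<close> times their distance puts the segment between them above the graph, so up,
  across and down is a curve of comparable length. Likewise a point raised by \<open>t / 2\<close>
  is the centre of a ball of radius proportional to \<open>t\<close> above the graph.\<close>

lemma lipschitz_epigraph_chart:
  fixes \<Omega> :: "'a::euclidean_space set" and g :: "'a \<Rightarrow> real"
  assumes r: "r > 0" and v: "norm v = 1"
    and g: "L-lipschitz_on {u. u \<bullet> v = 0} g"
    and \<Omega>: "\<Omega> \<inter> ball z r = {u \<in> ball z r. g (u - (u \<bullet> v) *\<^sub>R v) < u \<bullet> v}"
  shows "\<exists>s>0. \<exists>C\<ge>0. \<exists>\<kappa>>0. \<exists>R>0.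
    (\<forall>x\<in>\<Omega> \<inter> ball z s. \<forall>y\<in>\<Omega> \<inter> ball z s. joined \<Omega> (C * dist x y) x y) \<and>
    (\<forall>x\<in>\<Omega> \<inter> ball z s. \<forall>t. 0 < t \<and> t \<le> R \<longrightarrow> (\<exists>w. ball w (\<kappa> * t) \<subseteq> \<Omega> \<inter> ball x t))"
proof -
  have L: "L \<ge> 0" using g lipschitz_on_nonneg by blast
  have vv: "v \<bullet> v = 1" using v by (simp add: norm_eq_1)
  define pr where "pr u = u - (u \<bullet> v) *\<^sub>R v" for u
  have pr0: "pr u \<bullet> v = 0" for u by (simp add: pr_def inner_diff_left vv)
  have pr_norm: "norm (pr u) \<le> norm u" for u
  proof -
    have "(norm (pr u))\<^sup>2 = (norm u)\<^sup>2 - (u \<bullet> v)\<^sup>2"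
      unfolding power2_norm_eq_inner pr_def
      by (simp add: inner_diff_left inner_diff_right vv inner_commute power2_eq_square)
    then have "(norm (pr u))\<^sup>2 \<le> (norm u)\<^sup>2" by simp
    then show ?thesis by (rule power2_le_imp_le) simp
  qed
  have pr_diff: "pr u - pr w = pr (u - w)" for u w
    by (simp add: pr_def algebra_simps)
  \<comment> \<open>Orthogonal projection is 1-Lipschitz, so \<open>g\<close> composed with
    \<open>pr\<close> is \<open>L\<close>-Lipschitz on the whole space.\<close>
  have g_le: "g (pr u) \<le> g (pr w) + L * dist u w" for u w
  proof -
    have "dist (g (pr u)) (g (pr w)) \<le> L * dist (pr u) (pr w)"
      by (intro lipschitz_onD[OF g]) (simp_all add: pr0)
    also have "\<dots> \<le> L * dist u w"
      by (intro mult_left_mono L) (simp add: dist_norm pr_diff pr_norm)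
    finally show ?thesis by (simp add: dist_real_def)
  qed
  have pr_v: "pr (u + t *\<^sub>R v) = pr u" for u t by (simp add: pr_def algebra_simps vv)
  have mem: "u \<in> \<Omega> \<longleftrightarrow> g (pr u) < u \<bullet> v" if "u \<in> ball z r" for u
    using \<Omega> that unfolding pr_def by blast
  \<comment> \<open>Two points of \<open>ball z s\<close> are at most \<open>2 * s\<close> apart, so
    a lift moves them by at most \<open>2 * L * s\<close> and they stay within
    \<open>(1 + 2 * L) * s < r\<close> of \<open>z\<close>, where the epigraph description is
    valid.\<close>
  define s where "s = r / (2 + 2 * L)"
  have s: "s > 0" and sr: "s * (2 + 2 * L) = r" using r L by (auto simp: s_def)
  have sr': "2 * s + 2 * (L * s) = r" using sr by (simp add: algebra_simps)
  have Ls: "L * s \<ge> 0" using L s by simp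
  have path: "joined \<Omega> ((2 * L + 1) * dist x y) x y"
    if x: "x \<in> \<Omega> \<inter> ball z s" and y: "y \<in> \<Omega> \<inter> ball z s" for x y
  proof -
    define \<delta> where "\<delta> = dist x y"
    have \<delta>: "0 \<le> \<delta>" "\<delta> \<le> 2 * s"
      using x y dist_triangle3[of x y z] by (auto simp: \<delta>_def)
    have L\<delta>: "0 \<le> L * \<delta>" "L * \<delta> \<le> 2 * (L * s)" using \<delta> L
      by (simp, metis mult.left_commute mult_left_mono)
    let ?t = "(L * \<delta>) *\<^sub>R v"
    have in_ball: "u + c *\<^sub>R v \<in> ball z r" if "u \<in> ball z s" "\<bar>c\<bar> \<le> L * \<delta>" for u c
    proof -
      have "dist z (u + c *\<^sub>R v) \<le> dist z u + dist u (u + c *\<^sub>R v)"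
        by (rule dist_triangle)
      also have "dist u (u + c *\<^sub>R v) = \<bar>c\<bar>" by (simp add: dist_norm v)
      finally show ?thesis using that L\<delta> sr' s by simp
    qed
    have up: "closed_segment u (u + ?t) \<subseteq> \<Omega>" if u: "u \<in> \<Omega> \<inter> ball z s" for u
    proof
      fix w assume "w \<in> closed_segment u (u + ?t)"
      then obtain c where c: "0 \<le> c" "c \<le> 1" "w = (1 - c) *\<^sub>R u + c *\<^sub>R (u + ?t)"
        unfolding in_segment by blast
      then have w: "w = u + (c * (L * \<delta>)) *\<^sub>R v" by (simp add: algebra_simps)
      have cb: "0 \<le> c * (L * \<delta>)" "c * (L * \<delta>) \<le> L * \<delta>"
        using c L\<delta> by (auto intro: mult_left_le_one_le)
      have wb: "w \<in> ball z r" unfolding w using u cb by (intro in_ball) auto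
      have ub: "u \<in> ball z r" using in_ball[of u 0] u L\<delta> by simp
      have "g (pr w) < w \<bullet> v"
        using mem[OF ub] u cb by (simp add: w pr_v inner_add_left vv)
      then show "w \<in> \<Omega>" using mem[OF wb] by simp
    qed
    have across: "closed_segment (x + ?t) (y + ?t) \<subseteq> \<Omega>"
    proof
      fix w assume "w \<in> closed_segment (x + ?t) (y + ?t)"
      then obtain c where c: "0 \<le> c" "c \<le> 1" "w = (1 - c) *\<^sub>R (x + ?t) + c *\<^sub>R (y + ?t)"
        unfolding in_segment by blast
      define u where "u = (1 - c) *\<^sub>R x + c *\<^sub>R y"
      have w: "w = u + (L * \<delta>) *\<^sub>R v" using c by (simp add: u_def algebra_simps)
      have "u \<in> closed_segment x y" unfolding in_segment u_def using c by blast
      then have us: "u \<in> ball z s"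
        using closed_segment_subset[of x "ball z s" y] x y by auto
      have wb: "w \<in> ball z r" unfolding w by (intro in_ball us) (use L\<delta> in auto)
      have xb: "x \<in> ball z r" "y \<in> ball z r" using in_ball[of x 0] in_ball[of y 0] x y L\<delta> by auto
      have du: "dist u x = c * \<delta>" "dist u y = (1 - c) * \<delta>"
      proof -
        have "u - x = c *\<^sub>R (y - x)" "u - y = (1 - c) *\<^sub>R (x - y)"
          by (simp_all add: u_def algebra_simps)
        then show "dist u x = c * \<delta>" "dist u y = (1 - c) * \<delta>"
          using c by (simp_all add: dist_norm \<delta>_def norm_minus_commute)
      qed
      have "L * (c * \<delta>) = c * (L * \<delta>)" "L * ((1 - c) * \<delta>) = (1 - c) * (L * \<delta>)" by simp_all
      \<comment> \<open>The point \<open>u\<close> is no farther than \<delta> from either endpoint,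
        so the lift pays for the change of \<open>g\<close> seen from both.\<close>
      then have gu: "g (pr u) \<le> g (pr x) + L * \<delta>" "g (pr u) \<le> g (pr y) + L * \<delta>"
        using g_le[of u x] g_le[of u y] c L\<delta> mult_left_le_one_le[of "L * \<delta>" c]
          mult_left_le_one_le[of "L * \<delta>" "1 - c"] unfolding du by linarith+
      have "g (pr u) - L * \<delta> < x \<bullet> v" "g (pr u) - L * \<delta> < y \<bullet> v"
        using gu mem[OF xb(1)] mem[OF xb(2)] x y by auto
      \<comment> \<open>The library bound is an upper bound for convex combinations, hence the
        negated values.\<close>
      then have "g (pr u) - L * \<delta> < (1 - c) * (x \<bullet> v) + c * (y \<bullet> v)"
        using c convex_bound_lt[of "- (x \<bullet> v)" "- (g (pr u) - L * \<delta>)" "- (y \<bullet> v)" "1 - c" c] by simp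
      then have "g (pr w) < w \<bullet> v"
        by (simp add: w pr_v inner_add_left vv u_def)
      then show "w \<in> \<Omega>" using mem[OF wb] by simp
    qed
    have "joined \<Omega> (dist x (x + ?t)) x (x + ?t)" by (intro joined_segment up x)
    moreover have "joined \<Omega> (dist (x + ?t) (y + ?t)) (x + ?t) (y + ?t)"
      by (intro joined_segment across)
    moreover have "joined \<Omega> (dist y (y + ?t)) (y + ?t) y"
      by (intro joined_sym[OF joined_segment] up y)
    ultimately have "joined \<Omega> (dist x (x + ?t) + dist (x + ?t) (y + ?t) + dist y (y + ?t)) x y"
      by (blast intro: joined_trans)
    moreover have "dist x (x + ?t) = L * \<delta>" "dist y (y + ?t) = L * \<delta>"
      using L\<delta> L \<delta> by (simp_all add: dist_norm v)
    ultimately show ?thesis by (simp add: \<delta>_def algebra_simps)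
  qed
  \<comment> \<open>Inside the small ball the graph rises by at most \<open>L * \<kappa> * t\<close>
    and the height drops by at most \<open>\<kappa> * t\<close>; this value makes the two losses
    together equal to the lift \<open>t / 2\<close>.\<close>
  define \<kappa> where "\<kappa> = 1 / (2 * (L + 1))"
  have \<kappa>: "\<kappa> > 0" "\<kappa> * (L + 1) = 1/2" "\<kappa> \<le> 1/2" using L by (auto simp: \<kappa>_def field_simps)
  have cone: "\<exists>w. ball w (\<kappa> * t) \<subseteq> \<Omega> \<inter> ball x t"
    if x: "x \<in> \<Omega> \<inter> ball z s" and t: "0 < t" "t \<le> s" for x t
  proof (intro exI subsetI)
    let ?w = "x + (t / 2) *\<^sub>R v"
    fix u assume u: "u \<in> ball ?w (\<kappa> * t)"
    have \<kappa>t: "\<kappa> * t \<le> t / 2" using \<kappa>(3) t(1) by simp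
    have "dist x u \<le> dist x ?w + dist ?w u" by (rule dist_triangle)
    moreover have "dist x ?w = t / 2" using t by (simp add: dist_norm v)
    ultimately have xu: "dist x u < t" using u \<kappa>t by simp
    have "dist z u \<le> dist z x + dist x u" by (rule dist_triangle)
    then have ub: "u \<in> ball z r" using xu x t sr' Ls by simp
    have xb: "x \<in> ball z r" using x sr' Ls s by simp
    have "g (pr u) \<le> g (pr ?w) + L * dist u ?w" by (rule g_le)
    also have "\<dots> \<le> g (pr x) + L * (\<kappa> * t)"
      using u L by (auto simp: pr_v dist_commute intro!: mult_left_mono)
    also have "\<dots> < x \<bullet> v + L * (\<kappa> * t)" using mem[OF xb] x by simp
    also have "\<dots> = ?w \<bullet> v - \<kappa> * t"
      using arg_cong[OF \<kappa>(2), of "\<lambda>c. c * t"] by (simp add: inner_add_left vv algebra_simps)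
    also have "\<dots> \<le> u \<bullet> v"
    proof -
      have "(?w - u) \<bullet> v \<le> norm (?w - u) * norm v" by (rule norm_cauchy_schwarz)
      also have "\<dots> \<le> \<kappa> * t" using u by (simp add: v dist_norm)
      finally show ?thesis by (simp add: inner_diff_left)
    qed
    finally have "u \<in> \<Omega>" using mem[OF ub] by simp
    then show "u \<in> \<Omega> \<inter> ball x t" using xu by simp
  qed
  show ?thesis
    by (rule exI[of _ s], intro conjI s, rule exI[of _ "2 * L + 1"], intro conjI,
        use L in simp, rule exI[of _ \<kappa>], intro conjI \<kappa>(1), rule exI[of _ s], intro conjI s)
       (use path cone in auto)
qed

text \<open>Around interior points a convex ball does everything with straight segments; around
  boundary points the chart applies. Having one statement for all of the closure prepares the
  compactness argument.\<close>

lemma lipschitz_domain_locally_joined_and_cone: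
  fixes \<Omega> :: "'a::euclidean_space set"
  assumes "open \<Omega>" "lipschitz_boundary \<Omega>" "z \<in> closure \<Omega>"
  shows "\<exists>s>0. \<exists>C\<ge>0. \<exists>\<kappa>>0. \<exists>R>0.
    (\<forall>x\<in>\<Omega> \<inter> ball z s. \<forall>y\<in>\<Omega> \<inter> ball z s. joined \<Omega> (C * dist x y) x y) \<and>
    (\<forall>x\<in>\<Omega> \<inter> ball z s. \<forall>t. 0 < t \<and> t \<le> R \<longrightarrow> (\<exists>w. ball w (\<kappa> * t) \<subseteq> \<Omega> \<inter> ball x t))"
proof (cases "z \<in> \<Omega>")
  case True
  then obtain r where r: "r > 0" "ball z r \<subseteq> \<Omega>"
    using assms(1) open_contains_ball by blast
  have path: "joined \<Omega> (1 * dist x y) x y" if "x \<in> \<Omega> \<inter> ball z (r/2)" "y \<in> \<Omega> \<inter> ball z (r/2)" for x y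
  proof -
    have "closed_segment x y \<subseteq> ball z (r/2)" using that by (intro closed_segment_subset) auto
    also have "\<dots> \<subseteq> \<Omega>" using r by (intro order_trans[OF subset_ball r(2)]) auto
    finally show ?thesis using joined_segment by simp
  qed
  have cone: "\<exists>w. ball w (1 * t) \<subseteq> \<Omega> \<inter> ball x t"
    if "x \<in> \<Omega> \<inter> ball z (r/2)" "0 < t" "t \<le> r/2" for x t
  proof (intro exI[of _ x] Int_greatest)
    have "ball x t \<subseteq> ball z r"
    proof
      fix u assume "u \<in> ball x t"
      then show "u \<in> ball z r" using that dist_triangle[of z u x] by auto
    qed
    then show "ball x (1 * t) \<subseteq> \<Omega>" using r(2) by auto
  qed auto
  show ?thesis
    by (rule exI[of _ "r/2"], intro conjI, use r in simp, rule exI[of _ 1], intro conjI, simp,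
        rule exI[of _ 1], intro conjI, simp, rule exI[of _ "r/2"], intro conjI, use r in simp)
       (use path cone in auto)
next
  case False
  then have "z \<in> frontier \<Omega>" using assms by (simp add: frontier_def interior_open)
  then obtain r v L and g :: "'a \<Rightarrow> real" where "r > 0" "norm v = 1" "L-lipschitz_on {u. u \<bullet> v = 0} g"
    "\<Omega> \<inter> ball z r = {u \<in> ball z r. g (u - (u \<bullet> v) *\<^sub>R v) < u \<bullet> v}"
    using assms(2) unfolding lipschitz_boundary_def by meson
  then show ?thesis by (rule lipschitz_epigraph_chart)
qed

section \<open>From charts to the whole domain\<close>

text \<open>Being joined by some curve is an equivalence relation whose classes are open, since
  balls contain segments. The length is not controlled here; it is used only to connect finitely
  many charts to one base point.\<close>

lemma connected_open_joined:
  fixes S :: "'a::euclidean_space set"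
  assumes "open S" "connected S" "x \<in> S" "y \<in> S"
  shows "\<exists>l. joined S l x y"
proof (rule connected_equivalence_relation[OF assms(2-4)])
  show "\<exists>l. joined S l b a" if "\<exists>l. joined S l a b" for a b using that joined_sym by blast
  show "\<exists>l. joined S l a c" if "\<exists>l. joined S l a b" "\<exists>l. joined S l b c" for a b c
    using that joined_trans by blast
  show "\<exists>T. openin (top_of_set S) T \<and> a \<in> T \<and> (\<forall>b\<in>T. \<exists>l. joined S l a b)" if a: "a \<in> S" for a
  proof -
    obtain r where r: "r > 0" "ball a r \<subseteq> S" using assms(1) a open_contains_ball by blast
    have "\<exists>l. joined S l a b" if "b \<in> ball a r" for b
    proof -
      have "closed_segment a b \<subseteq> ball a r" using that r by (intro closed_segment_subset) auto
      then show ?thesis using r joined_segment by blast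
    qed
    moreover have "openin (top_of_set S) (ball a r)" using r by (intro open_openin_trans assms) auto
    ultimately show ?thesis using r by (intro exI[of _ "ball a r"]) auto
  qed
qed

text \<open>A compactness argument: nearby points lie in a common chart, and distant ones are joined
  through finitely many base points, one for each chart.\<close>

lemma lipschitz_domain_quasiconvex_and_cone:
  fixes \<Omega> :: "'a::euclidean_space set"
  assumes \<Omega>: "open \<Omega>" "connected \<Omega>" "bounded \<Omega>" "lipschitz_boundary \<Omega>"
  shows "\<exists>C\<ge>0. \<forall>x\<in>\<Omega>. \<forall>y\<in>\<Omega>. joined \<Omega> (C * dist x y) x y"
    and "\<exists>\<kappa>>0. \<exists>R>0. \<forall>x\<in>\<Omega>. \<forall>t. 0 < t \<and> t \<le> R \<longrightarrow> (\<exists>w. ball w (\<kappa> * t) \<subseteq> \<Omega> \<inter> ball x t)"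
proof -
  obtain s C \<kappa> R where loc: "\<And>z. z \<in> closure \<Omega> \<Longrightarrow> s z > 0 \<and> C z \<ge> 0 \<and> \<kappa> z > 0 \<and> R z > 0 \<and>
    (\<forall>x\<in>\<Omega> \<inter> ball z (s z). \<forall>y\<in>\<Omega> \<inter> ball z (s z). joined \<Omega> (C z * dist x y) x y) \<and>
    (\<forall>x\<in>\<Omega> \<inter> ball z (s z). \<forall>t. 0 < t \<and> t \<le> R z \<longrightarrow> (\<exists>w. ball w (\<kappa> z * t) \<subseteq> \<Omega> \<inter> ball x t))"
    using lipschitz_domain_locally_joined_and_cone[OF \<Omega>(1,4)] by metis
  have comp: "compact (closure \<Omega>)" using \<Omega>(3) by simp
  have "closure \<Omega> \<subseteq> (\<Union>z\<in>closure \<Omega>. ball z (s z))"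
  proof
    fix z assume "z \<in> closure \<Omega>"
    moreover from this have "s z > 0" using loc by blast
    ultimately show "z \<in> (\<Union>z\<in>closure \<Omega>. ball z (s z))" by (intro UN_I[of z]) auto
  qed
  then obtain Z where Z: "Z \<subseteq> closure \<Omega>" "finite Z" "closure \<Omega> \<subseteq> (\<Union>z\<in>Z. ball z (s z))"
    by (rule compactE_image[OF comp open_ball])
  have ZL: "s z > 0" "C z \<ge> 0" "\<kappa> z > 0" "R z > 0" if "z \<in> Z" for z
    using loc that Z(1) by blast+
  have Zj: "joined \<Omega> (C z * dist x y) x y"
    if "z \<in> Z" "x \<in> \<Omega>" "y \<in> \<Omega>" "x \<in> ball z (s z)" "y \<in> ball z (s z)" for x y z
    using loc that Z(1) by blast
  have Zc: "\<exists>w. ball w (\<kappa> z * t) \<subseteq> \<Omega> \<inter> ball x t"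
    if "z \<in> Z" "x \<in> \<Omega>" "x \<in> ball z (s z)" "0 < t" "t \<le> R z" for x z t
    using loc that Z(1) by blast
  have cov: "\<exists>z\<in>Z. x \<in> ball z (s z)" if "x \<in> \<Omega>" for x
    using that Z(3) closure_subset by blast
  show "\<exists>\<kappa>>0. \<exists>R>0. \<forall>x\<in>\<Omega>. \<forall>t. 0 < t \<and> t \<le> R \<longrightarrow> (\<exists>w. ball w (\<kappa> * t) \<subseteq> \<Omega> \<inter> ball x t)"
  proof -
    \<comment> \<open>The inserted 1 keeps both minima defined and positive even if \<open>Z\<close>
      is empty.\<close>
    let ?k = "Min (insert 1 (\<kappa> ` Z))" and ?R = "Min (insert 1 (R ` Z))"
    have "?k > 0" "?R > 0" using Z(2) ZL by auto
    moreover have "\<exists>w. ball w (?k * t) \<subseteq> \<Omega> \<inter> ball x t"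
      if x: "x \<in> \<Omega>" and t: "0 < t \<and> t \<le> ?R" for x t
    proof -
    obtain z where z: "z \<in> Z" "x \<in> ball z (s z)" using cov x by blast
    have "?k \<le> \<kappa> z" "?R \<le> R z" using Z(2) z(1) by (auto intro: Min_le)
    then obtain w where w: "ball w (\<kappa> z * t) \<subseteq> \<Omega> \<inter> ball x t"
      using Zc[OF z(1) x z(2), of t] t by auto
    have "ball w (?k * t) \<subseteq> ball w (\<kappa> z * t)"
      using \<open>?k \<le> \<kappa> z\<close> t by (intro subset_ball mult_right_mono) auto
    then show "\<exists>w. ball w (?k * t) \<subseteq> \<Omega> \<inter> ball x t" using w by blast
    qed
    ultimately show ?thesis by blast
  qed
  show "\<exists>C\<ge>0. \<forall>x\<in>\<Omega>. \<forall>y\<in>\<Omega>. joined \<Omega> (C * dist x y) x y"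
  proof (cases "\<Omega> = {}")
    case False
    then obtain o0 where o0: "o0 \<in> \<Omega>" by blast
    \<comment> \<open>A Lebesgue number of the cover: points closer than \<open>e\<close> share a
      chart.\<close>
    obtain e where e: "e > 0" "\<And>x. x \<in> closure \<Omega> \<Longrightarrow> \<exists>G\<in>(\<lambda>z. ball z (s z)) ` Z. ball x e \<subseteq> G"
      using Heine_Borel_lemma[OF comp Z(3)] by blast
    \<comment> \<open>The centre \<open>z\<close> may lie on the boundary, so the curve from
      \<open>o0\<close> first reaches some \<open>q\<close> of the domain inside the chart and then
      continues within the chart, whose diameter is at most \<open>2 * s z\<close>. One length thus
      serves the whole chart.\<close>
    have Zl: "\<exists>b l. \<forall>x\<in>\<Omega> \<inter> ball z (s z). joined \<Omega> l b x \<and> b = o0" if "z \<in> Z" for z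
    proof (cases "\<Omega> \<inter> ball z (s z) = {}")
      case False
      then obtain q where q: "q \<in> \<Omega>" "q \<in> ball z (s z)" by blast
      obtain l where l: "joined \<Omega> l o0 q"
        using connected_open_joined[OF \<Omega>(1,2) o0 q(1)] by blast
      have "joined \<Omega> (l + C z * (2 * s z)) o0 x" if "x \<in> \<Omega> \<inter> ball z (s z)" for x
      proof (rule joined_trans[OF l joined_mono])
        show "joined \<Omega> (C z * dist q x) q x" using Zj \<open>z \<in> Z\<close> q that by auto
        have "dist q x \<le> 2 * s z" using q that dist_triangle3[of q x z] by auto
        then show "C z * dist q x \<le> C z * (2 * s z)" using ZL[OF \<open>z \<in> Z\<close>] by (intro mult_left_mono) auto
      qed
      then show ?thesis by blast
    qed auto
    then obtain l where l: "\<And>z x. z \<in> Z \<Longrightarrow> x \<in> \<Omega> \<inter> ball z (s z) \<Longrightarrow> joined \<Omega> (l z) o0 x"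
      by metis
    define D where "D = Max (insert 0 (l ` Z))"
    have D: "D \<ge> 0" using Z(2) by (simp add: D_def)
    have jD: "joined \<Omega> D o0 x" if x: "x \<in> \<Omega>" for x
    proof -
      obtain z where z: "z \<in> Z" "x \<in> ball z (s z)" using cov x by blast
      have "l z \<le> D" unfolding D_def using Z(2) z(1) by (intro Max_ge) auto
      then show ?thesis using joined_mono l z x by blast
    qed
    define K where "K = Max (insert 0 (C ` Z))"
    have K: "K \<ge> 0" using Z(2) by (simp add: K_def)
    \<comment> \<open>The summand \<open>K\<close> handles pairs in a common chart. Other pairs are
      joined through \<open>o0\<close> at cost \<open>2 * D\<close>, which is at most
      \<open>2 * D / e\<close> times their distance.\<close>
    let ?C = "K + 2 * D / e"
    have "joined \<Omega> (?C * dist x y) x y" if xy: "x \<in> \<Omega>" "y \<in> \<Omega>" for x y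
    proof (cases "dist x y < e")
      case True
      obtain z where z: "z \<in> Z" "ball x e \<subseteq> ball z (s z)"
        using e(2) xy(1) closure_subset by blast
      have "C z \<le> K" unfolding K_def using Z(2) z(1) by (intro Max_ge) auto
      moreover have "0 \<le> 2 * D / e" using D e(1) by simp
      ultimately have le: "C z \<le> ?C" by linarith
      have "joined \<Omega> (C z * dist x y) x y"
        using True e(1) by (intro Zj[OF z(1) xy] subsetD[OF z(2)]) auto
      then show ?thesis by (rule joined_mono) (simp add: mult_right_mono[OF le])
    next
      case False
      have "joined \<Omega> (D + D) x y"
        by (rule joined_trans[OF joined_sym[OF jD[OF xy(1)]] jD[OF xy(2)]])
      moreover have "D + D \<le> ?C * dist x y"
      proof -
        have "D + D = 2 * D / e * e" using e(1) by simp
        also have "\<dots> \<le> 2 * D / e * dist x y"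
          using False D e(1) by (intro mult_left_mono) auto
        also have "\<dots> \<le> ?C * dist x y" using K by (intro mult_right_mono) auto
        finally show ?thesis .
      qed
      ultimately show ?thesis by (rule joined_mono)
    qed
    moreover have "?C \<ge> 0" using K D e(1) by simp
    ultimately show ?thesis by blast
  qed auto
qed

section \<open>Density of random samples\<close>

text \<open>A ball centred near the boundary may lie largely outside the domain. The inscribed ball
  from the cone condition retains a fixed fraction of its volume, and there the density is at least
  \<open>c\<close>.\<close>

lemma measure_ball_lower_bound:
  fixes \<Omega> :: "'a::euclidean_space set" and \<rho> :: "'a \<Rightarrow> real"
  assumes mu: "prob_space \<mu>" "\<mu> = density lborel (\<lambda>u. ennreal (indicator \<Omega> u * \<rho> u))"
    and \<Omega>: "open \<Omega>" "continuous_on \<Omega> \<rho>" and c: "c > 0" "\<And>u. u \<in> \<Omega> \<Longrightarrow> c \<le> \<rho> u"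
    and \<kappa>: "\<kappa> > 0" "t > 0" and w: "ball w (\<kappa> * t) \<subseteq> \<Omega> \<inter> ball u t"
  shows "c * unit_ball_vol (real DIM('a)) * \<kappa> ^ DIM('a) * t ^ DIM('a) \<le> measure \<mu> (ball u t)"
proof -
  interpret prob_space \<mu> by fact
  have [measurable]: "(\<lambda>u. indicator \<Omega> u * \<rho> u) \<in> borel_measurable borel"
    using borel_measurable_continuous_on_indicator[OF _ \<Omega>(2)] \<Omega>(1) by simp
  have "ennreal (c * (unit_ball_vol (real DIM('a)) * (\<kappa> * t) ^ DIM('a)))
      = ennreal c * emeasure lborel (ball w (\<kappa> * t))"
    using c \<kappa> by (simp add: emeasure_ball ennreal_mult)
  also have "\<dots> = (\<integral>\<^sup>+ z. ennreal c * indicator (ball w (\<kappa> * t)) z \<partial>lborel)"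
    by (simp add: nn_integral_cmult_indicator)
  also have "\<dots> \<le> (\<integral>\<^sup>+ z. ennreal (indicator \<Omega> z * \<rho> z) * indicator (ball u t) z \<partial>lborel)"
    using w c(2) by (intro nn_integral_mono) (auto simp: indicator_def intro!: ennreal_leI)
  also have "\<dots> = emeasure \<mu> (ball u t)"
    by (subst mu(2), subst emeasure_density) auto
  also have "\<dots> = ennreal (measure \<mu> (ball u t))" by (rule emeasure_eq_measure)
  finally show ?thesis by (simp add: power_mult_distrib mult_ac)
qed

text \<open>A separated set of greatest cardinality is a net, since an uncovered point could be
  added. Half-radius balls around separated points are disjoint and each has mass at least
  \<open>c\<close>, while the total mass is 1; this bounds the cardinality.\<close>

lemma finite_net:
  fixes S :: "'a::euclidean_space set" and c t :: real
  assumes \<mu>: "prob_space \<mu>" and sets: "sets \<mu> = sets borel" and c: "c > 0" and t: "t > 0"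
    and S: "\<And>u. u \<in> S \<Longrightarrow> c \<le> measure \<mu> (ball u (t / 2))"
  shows "\<exists>T\<subseteq>S. finite T \<and> card T * c \<le> 1 \<and> (\<forall>u\<in>S. \<exists>v\<in>T. dist u v < t)"
proof -
  interpret prob_space \<mu> by fact
  define sep where "sep T \<longleftrightarrow> T \<subseteq> S \<and> finite T \<and> (\<forall>u\<in>T. \<forall>v\<in>T. u \<noteq> v \<longrightarrow> t \<le> dist u v)" for T
  have card: "card T * c \<le> 1" if "sep T" for T
  proof -
    have "disjoint_family_on (\<lambda>u. ball u (t / 2)) T"
      unfolding disjoint_family_on_def
    proof (intro ballI impI equals0I)
      fix u v z assume "u \<in> T" "v \<in> T" "u \<noteq> v" and z: "z \<in> ball u (t / 2) \<inter> ball v (t / 2)"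
      then have "t \<le> dist u v" using that by (auto simp: sep_def)
      also have "\<dots> < t" using z dist_triangle2[of u v z] by (simp add: dist_commute)
      finally show False by simp
    qed
    then have "measure \<mu> (\<Union>u\<in>T. ball u (t / 2)) = (\<Sum>u\<in>T. measure \<mu> (ball u (t / 2)))"
      using that sets by (intro finite_measure_finite_Union) (auto simp: sep_def)
    moreover have "card T * c \<le> (\<Sum>u\<in>T. measure \<mu> (ball u (t / 2)))"
      using that S by (intro sum_bounded_below) (auto simp: sep_def)
    ultimately show ?thesis using prob_space.prob_le_1[OF \<mu>, of "\<Union>u\<in>T. ball u (t / 2)"] by linarith
  qed
  have "\<forall>T. sep T \<longrightarrow> card T < Suc (nat \<lfloor>1 / c\<rfloor>)"
    using card c by (auto simp: less_Suc_eq_le le_nat_floor pos_le_divide_eq)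
  moreover have "sep {}" by (simp add: sep_def)
  ultimately obtain T where T: "sep T" "\<And>T'. sep T' \<Longrightarrow> card T' \<le> card T"
    using ex_has_greatest_nat[of sep "{}" card "Suc (nat \<lfloor>1 / c\<rfloor>)"] by metis
  have "\<exists>v\<in>T. dist u v < t" if u: "u \<in> S" for u
  proof (rule ccontr)
    assume *: "\<not> (\<exists>v\<in>T. dist u v < t)"
    then have "u \<notin> T" using t by auto
    have "sep (insert u T)"
      using T(1) u * unfolding sep_def by (auto simp: dist_commute not_less)
    from T(2)[OF this] show False
      using \<open>u \<notin> T\<close> T(1) by (simp add: sep_def)
  qed
  then show ?thesis using T(1) card unfolding sep_def by blast
qed

section \<open>Concentration of sample counts\<close>

text \<open>Markov's inequality for \<open>exp (- S)\<close>, where \<open>S\<close> counts the successes.\<close>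

lemma (in prob_space) indep_count_lower_tail:
  fixes q :: real
  assumes indep: "indep_vars (\<lambda>_. N) X I" and J: "finite J" "J \<subseteq> I" and A: "A \<in> sets N"
    and q: "\<And>i. i \<in> J \<Longrightarrow> q \<le> prob {\<omega>\<in>space M. X i \<omega> \<in> A}"
  shows "prob {\<omega>\<in>space M. card {i\<in>J. X i \<omega> \<in> A} \<le> q * card J / 4} \<le> exp (- (q * card J / 4))"
    and "{\<omega>\<in>space M. card {i\<in>J. X i \<omega> \<in> A} \<le> q * card J / 4} \<in> events"
proof -
  have indepJ: "indep_vars (\<lambda>_. N) X J" using indep_vars_subset[OF indep J(2)] .
  have Xm: "X i \<in> measurable M N" if "i \<in> J" for i using indepJ that by (simp add: indep_vars_def)
  define h where "h z = exp (- indicat_real A z)" for z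
  have hm [measurable]: "h \<in> borel_measurable N" unfolding h_def using A by measurable
  have Y: "indep_vars (\<lambda>_. borel) (\<lambda>i \<omega>. h (X i \<omega>)) J"
    using indep_vars_compose2[OF indepJ, of "\<lambda>_. h" "\<lambda>_. borel"] hm by simp
  have Ym: "(\<lambda>\<omega>. h (X i \<omega>)) \<in> borel_measurable M" if "i \<in> J" for i
    using measurable_compose[OF Xm[OF that] hm] .
  have int: "integrable M (\<lambda>\<omega>. h (X i \<omega>))" if "i \<in> J" for i
    using Ym[OF that] by (intro integrable_const_bound[of _ 1]) (auto simp: h_def)
  have prod: "(\<Prod>i\<in>J. h (X i \<omega>)) = exp (- real (card {i\<in>J. X i \<omega> \<in> A}))" for \<omega>
  proof -
    have "(\<Prod>i\<in>J. h (X i \<omega>)) = exp (\<Sum>i\<in>J. - indicat_real A (X i \<omega>))"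
      unfolding h_def using J(1) by (simp add: exp_sum)
    also have "(\<Sum>i\<in>J. - indicat_real A (X i \<omega>)) = - (\<Sum>i\<in>J. if X i \<omega> \<in> A then 1 else 0)"
      by (simp add: sum_negf indicator_def of_bool_def)
    also have "(\<Sum>i\<in>J. if X i \<omega> \<in> A then 1 else 0 :: real) = real (card {i\<in>J. X i \<omega> \<in> A})"
      using J(1) by (simp flip: sum.inter_filter)
    finally show ?thesis .
  qed
  have e2: "exp (- 1) \<le> (1/2 :: real)"
    using exp_ge_add_one_self[of "1::real"] by (simp add: exp_minus field_simps)
  \<comment> \<open>Since \<open>exp (- 1) \<le> 1/2\<close>, the variable is at most 1 minus half
    the indicator of success, so its mean is at most \<open>1 - q / 2\<close>.\<close>
  have EY: "expectation (\<lambda>\<omega>. h (X i \<omega>)) \<le> exp (- (q / 2))" if i: "i \<in> J" for i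
  proof -
    let ?E = "{\<omega>\<in>space M. X i \<omega> \<in> A}"
    have E: "?E \<in> events" using measurable_sets[OF Xm[OF i] A] by (simp add: vimage_def Int_def conj_commute)
    have Ei: "integrable M (\<lambda>\<omega>. (1/2) * indicat_real ?E \<omega>)"
      by (intro integrable_mult_right integrable_real_indicator E) (simp add: emeasure_eq_measure)
    have "expectation (\<lambda>\<omega>. h (X i \<omega>)) \<le> expectation (\<lambda>\<omega>. 1 - (1/2) * indicat_real ?E \<omega>)"
    proof (intro integral_mono int i)
      show "integrable M (\<lambda>\<omega>. 1 - (1/2) * indicat_real ?E \<omega>)"
        by (intro Bochner_Integration.integrable_diff integrable_const Ei)
      show "h (X i \<omega>) \<le> 1 - (1/2) * indicat_real ?E \<omega>" if "\<omega> \<in> space M" for \<omega>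
        using that e2 by (auto simp: h_def indicator_def)
    qed
    also have "\<dots> = 1 - (1/2) * prob ?E"
      using E by (subst Bochner_Integration.integral_diff[OF integrable_const Ei]) (simp add: prob_space)
    also have "\<dots> \<le> 1 + (- (q / 2))" using q[OF i] by simp
    also have "\<dots> \<le> exp (- (q / 2))" by (rule exp_ge_add_one_self)
    finally show ?thesis .
  qed
  let ?B = "{\<omega>\<in>space M. card {i\<in>J. X i \<omega> \<in> A} \<le> q * card J / 4}"
  let ?P = "\<lambda>\<omega>. \<Prod>i\<in>J. h (X i \<omega>)"
  have B: "?B = {\<omega>\<in>space M. exp (- (q * card J / 4)) \<le> ?P \<omega>}"
    unfolding prod by auto
  have Pm: "?P \<in> borel_measurable M" using Ym by (intro borel_measurable_prod) auto
  then show ev: "?B \<in> events" unfolding B by measurable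
  have Pint: "integrable M ?P" by (intro indep_vars_integrable J Y int)
  have "exp (- (q * card J / 4)) * prob ?B \<le> expectation ?P"
  proof -
    have "exp (- (q * card J / 4)) * prob ?B
        = expectation (\<lambda>\<omega>. exp (- (q * card J / 4)) * indicat_real ?B \<omega>)"
      using ev by simp
    also have "\<dots> \<le> expectation ?P"
    proof (intro integral_mono Pint)
      show "integrable M (\<lambda>\<omega>. exp (- (q * card J / 4)) * indicat_real ?B \<omega>)"
        by (intro integrable_mult_right integrable_real_indicator ev) (simp add: emeasure_eq_measure)
      show "exp (- (q * card J / 4)) * indicat_real ?B \<omega> \<le> ?P \<omega>" for \<omega>
        unfolding prod by (auto simp: indicator_def)
    qed
    finally show ?thesis .
  qed
  also have "expectation ?P = (\<Prod>i\<in>J. expectation (\<lambda>\<omega>. h (X i \<omega>)))"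
    by (intro indep_vars_lebesgue_integral J Y int)
  also have "\<dots> \<le> (\<Prod>i\<in>J. exp (- (q / 2)))"
    using EY by (intro prod_mono) (auto simp: h_def intro!: integral_nonneg)
  \<comment> \<open>The product bound \<open>exp (- (q * card J / 2))\<close> is the square of the
    Markov threshold; one factor cancels and the other is the tail bound.\<close>
  also have "\<dots> = exp (- (q * card J / 4)) * exp (- (q * card J / 4))"
    by (simp add: exp_of_nat_mult[symmetric] exp_add[symmetric] field_simps)
  finally show "prob ?B \<le> exp (- (q * card J / 4))" by simp
qed

text \<open>With l the connectivity scale, n l^d is eventually at least ln n: it equals ln n for d
  >= 3, (ln n)^(3/2) for d = 2 and sqrt (n ln ln n) for d = 1. The diverging ratio then absorbs any
  constant \<open>K\<close>.\<close>

lemma conn_scale_growth: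
  assumes d: "d \<ge> 1" and lim: "filterlim (\<lambda>n. \<epsilon> n / conn_scale d n) at_top sequentially"
  shows "eventually (\<lambda>n. K * ln (real n) \<le> real n * \<epsilon> n ^ d) sequentially"
proof -
  \<comment> \<open>Being at least 1 gives \<open>K' \<le> K' ^ d\<close>, so the ratio need only
    exceed \<open>K'\<close> itself.\<close>
  define K' where "K' = max 1 K"
  have K': "K' \<ge> 1" "K' \<ge> K" by (auto simp: K'_def)
  have base: "eventually (\<lambda>n. conn_scale d n > 0 \<and> ln (real n) \<le> real n * conn_scale d n ^ d) sequentially"
  proof -
    consider "d = 1" | "d = 2" | "d \<ge> 3" using d by linarith
    then show ?thesis
    proof cases
      case 1
      have "eventually (\<lambda>n::nat. sqrt (ln (ln (real n)) / real n) > 0) sequentially" by real_asymp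
      moreover have "eventually (\<lambda>n::nat. ln (real n) \<le> real n * sqrt (ln (ln (real n)) / real n)) sequentially"
        by real_asymp
      ultimately show ?thesis unfolding 1 conn_scale_def by eventually_elim simp
    next
      case 2
      have "eventually (\<lambda>n::nat. ln (real n) powr (3/4) / sqrt (real n) > 0) sequentially" by real_asymp
      moreover have "eventually (\<lambda>n::nat. ln (real n) \<le> real n * (ln (real n) powr (3/4) / sqrt (real n)) ^ 2) sequentially"
        by real_asymp
      ultimately show ?thesis unfolding 2 conn_scale_def by eventually_elim simp
    next
      case 3
      have "eventually (\<lambda>n::nat. ln (real n) / real n > 0) sequentially" by real_asymp
      then show ?thesis
      proof eventually_elim
        case (elim n)
        have n: "real n \<noteq> 0" using elim by (cases "n = 0") auto
        moreover have "ln (real n) \<noteq> 0" using elim by auto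
        ultimately have "((ln (real n) / real n) powr (1 / real d)) ^ d = ln (real n) / real n"
          using elim 3 by (subst powr_power) auto
        moreover have "(ln (real n) / real n) powr (1 / real d) > 0"
          unfolding powr_gt_zero using less_imp_neq[OF elim] by metis
        ultimately show ?case using 3 n by (simp add: conn_scale_def)
      qed
    qed
  qed
  have "eventually (\<lambda>n. K' \<le> \<epsilon> n / conn_scale d n) sequentially"
    using lim by (simp add: filterlim_at_top)
  moreover have "eventually (\<lambda>n::nat. ln (real n) \<ge> 0) sequentially" by real_asymp
  ultimately show ?thesis using base
  proof eventually_elim
    case (elim n)
    have "K * ln (real n) \<le> K' ^ 1 * ln (real n)"
      using elim K' by (intro mult_right_mono) auto
    also have "\<dots> \<le> K' ^ d * (real n * conn_scale d n ^ d)"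
      using elim K' d by (intro mult_mono power_increasing) auto
    also have "\<dots> = real n * (K' * conn_scale d n) ^ d" by (simp add: power_mult_distrib)
    also have "\<dots> \<le> real n * \<epsilon> n ^ d"
      using elim K' by (intro mult_left_mono power_mono) (auto simp: pos_le_divide_eq)
    finally show ?case .
  qed
qed

text \<open>Union bound over a net of at most \<open>1 / q n\<close> points, where each of them sees at most a quarter
  of the expected number of samples with probability at most \<open>1 / n\<^sup>3\<close>; then Borel--Cantelli.\<close>

lemma eventually_many_samples_in_balls:
  fixes S :: "'a::euclidean_space set" and x :: "nat \<Rightarrow> 'w \<Rightarrow> 'a"
  assumes M: "prob_space M" and \<mu>: "prob_space \<mu>" "sets \<mu> = sets borel"
    and meas: "\<And>i. i > N \<Longrightarrow> x i \<in> borel_measurable M"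
    and distr: "\<And>i. i > N \<Longrightarrow> distr M borel (x i) = \<mu>"
    and indep: "prob_space.indep_vars M (\<lambda>_. borel) x {N<..}"
    and c: "c > 0" "R > 0" "\<And>u t. u \<in> S \<Longrightarrow> 0 < t \<Longrightarrow> t \<le> R \<Longrightarrow> c * t ^ DIM('a) \<le> measure \<mu> (ball u t)"
    and r: "r > 0" and eps: "\<forall>n\<ge>1. \<epsilon> n > 0" "\<epsilon> \<longlonglongrightarrow> 0"
    and growth: "\<And>K. eventually (\<lambda>n. K * ln (real n) \<le> real n * \<epsilon> n ^ DIM('a)) sequentially"
  shows "\<exists>c'>0. AE \<omega> in M. eventually (\<lambda>n. \<forall>u\<in>S.
    c' * real n * \<epsilon> n ^ DIM('a) \<le> card {i\<in>{1..n}. x i \<omega> \<in> ball u (r * \<epsilon> n)}) sequentially"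
proof -
  interpret prob_space M by fact
  let ?d = "DIM('a)"
  \<comment> \<open>The net is \<open>t n\<close>-separated with
    \<open>t n = r * \<epsilon> n / 2\<close>, so the mass bound is applied at half that radius,
    \<open>r * \<epsilon> n / 4\<close>.\<close>
  define c1 where "c1 = c * (r / 4) ^ ?d"
  have c1: "c1 > 0" using c r by (simp add: c1_def)
  define t where "t n = r * \<epsilon> n / 2" for n
  define q where "q n = c1 * \<epsilon> n ^ ?d" for n
  \<comment> \<open>The conditions leave at least \<open>n / 2\<close> random samples, make the mass
    bound applicable, force the tail exponent \<open>q n * card (J n) / 4\<close> above
    \<open>3 * ln n\<close> (whence 24 = 3 * 4 * 2), and limit the net to \<open>n\<close>
    points.\<close>
  define good where "good n \<longleftrightarrow> 2 * N < n \<and> t n \<le> R \<and> 24 * ln (real n) \<le> real n * q n \<and> 1 \<le> real n * q n" for n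
  have gn: "0 < t n" "0 < q n" "q n = c * (t n / 2) ^ ?d" if "good n" for n
  proof -
    have "\<epsilon> n > 0" using that eps(1) by (simp add: good_def)
    then show "0 < t n" "0 < q n" using r c1 by (auto simp: t_def q_def)
    show "q n = c * (t n / 2) ^ ?d"
      by (simp add: q_def c1_def t_def power_mult_distrib power_divide)
  qed
  have ev_good: "eventually good sequentially"
  proof -
    have "eventually (\<lambda>n. \<epsilon> n < 2 * R / r) sequentially"
      using eps(2) c(2) r by (intro order_tendstoD(2)) auto
    moreover have "eventually (\<lambda>n. 2 * N < n) sequentially" by (rule eventually_gt_at_top)
    moreover have "eventually (\<lambda>n::nat. ln (real n) \<ge> 1) sequentially" by real_asymp
    ultimately show ?thesis using growth[of "24 / c1"]
    proof eventually_elim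
      case (elim n)
      have "24 * ln (real n) = c1 * (24 / c1 * ln (real n))" using c1 by simp
      also have "\<dots> \<le> c1 * (real n * \<epsilon> n ^ ?d)" using elim c1 by (intro mult_left_mono) auto
      finally have *: "24 * ln (real n) \<le> real n * q n" by (simp add: q_def mult_ac)
      have "t n \<le> R" using elim(1) r by (simp add: t_def field_simps)
      then show ?case unfolding good_def using * elim by auto
    qed
  qed
  have "\<exists>T. good n \<longrightarrow> T \<subseteq> S \<and> finite T \<and> card T * q n \<le> 1 \<and> (\<forall>u\<in>S. \<exists>v\<in>T. dist u v < t n)" for n
  proof (cases "good n")
    case True
    then show ?thesis
      using finite_net[OF \<mu>, of "q n" "t n" S] gn[OF True] c by (force simp: good_def)
  qed auto
  then obtain T where T: "\<And>n. good n \<Longrightarrow> T n \<subseteq> S" "\<And>n. good n \<Longrightarrow> finite (T n)"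
    "\<And>n. good n \<Longrightarrow> card (T n) * q n \<le> 1"
    "\<And>n u. good n \<Longrightarrow> u \<in> S \<Longrightarrow> \<exists>v\<in>T n. dist u v < t n"
    by metis
  define J where "J n = {N<..n}" for n
  define E where "E n v = {\<omega>\<in>space M. card {i\<in>J n. x i \<omega> \<in> ball v (t n)} \<le> q n * card (J n) / 4}" for n v
  \<comment> \<open>The empty set for the finitely many bad \<open>n\<close> makes every
    \<open>A n\<close> measurable without affecting summability.\<close>
  define A where "A n = (if good n then \<Union>v\<in>T n. E n v else {})" for n
  have J: "real n / 2 \<le> card (J n)" if "good n" for n
    using that by (auto simp: J_def good_def)
  have E: "E n v \<in> events" "prob (E n v) \<le> exp (- (q n * card (J n) / 4))"
    if n: "good n" and v: "v \<in> T n" for n v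
  proof -
    have vS: "v \<in> S" using T(1)[OF n] v by blast
    have "q n \<le> prob {\<omega>\<in>space M. x i \<omega> \<in> ball v (t n)}" if "i \<in> J n" for i
    proof -
      have i: "i > N" using that by (simp add: J_def)
      have "q n \<le> c * t n ^ ?d"
        unfolding gn(3)[OF n] using gn(1)[OF n] c(1) by (intro mult_left_mono power_mono) auto
      also have "\<dots> \<le> measure \<mu> (ball v (t n))"
        using vS gn[OF n] n by (intro c(3)) (auto simp: good_def)
      also have "\<dots> = prob {\<omega>\<in>space M. x i \<omega> \<in> ball v (t n)}"
        unfolding distr[OF i, symmetric] using meas[OF i]
        by (subst measure_distr) (auto simp: vimage_def Int_def conj_commute)
      finally show ?thesis .
    qed
    note * = indep_count_lower_tail[OF indep _ _ _ this, of "J n"]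
    show "E n v \<in> events" unfolding E_def by (rule *(2)) (auto simp: J_def)
    show "prob (E n v) \<le> exp (- (q n * card (J n) / 4))"
      unfolding E_def by (rule *(1)) (auto simp: J_def)
  qed
  have Am: "A n \<in> events" for n
    unfolding A_def using E T(2) by (auto intro!: sets.finite_UN)
  have Ap: "prob (A n) \<le> 1 / real n ^ 2" if n: "good n" for n
  proof -
    have n0: "real n > 0" using n by (simp add: good_def)
    have "prob (A n) \<le> (\<Sum>v\<in>T n. prob (E n v))"
      unfolding A_def using n E T(2) by (auto intro!: finite_measure_subadditive_finite)
    also have "\<dots> \<le> card (T n) * exp (- (q n * card (J n) / 4))"
      using E[OF n] by (intro sum_bounded_above) auto
    also have "\<dots> \<le> real n * exp (- 3 * ln (real n))"
    proof (intro mult_mono)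
      have "card (T n) * q n \<le> real n * q n" using T(3)[OF n] n by (simp add: good_def)
      then show "real (card (T n)) \<le> real n" using gn(2)[OF n] by simp
      have "24 * ln (real n) \<le> real n * q n" using n by (simp add: good_def)
      also have "\<dots> \<le> 2 * card (J n) * q n" using J[OF n] gn(2)[OF n] by (intro mult_right_mono) auto
      finally show "exp (- (q n * card (J n) / 4)) \<le> exp (- 3 * ln (real n))" by (simp add: mult_ac)
    qed auto
    also have "exp (- 3 * ln (real n)) = 1 / real n ^ 3"
    proof -
      have "- 3 * ln (real n) = - ln (real n ^ 3)" using n0 by (simp add: ln_realpow)
      moreover have "exp (- ln (real n ^ 3)) = 1 / real n ^ 3"
        using n0 by (simp add: exp_minus inverse_eq_divide)
      ultimately show ?thesis by metis
    qed
    finally show ?thesis using n0 by (simp add: power2_eq_square power3_eq_cube)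
  qed
  have "summable (\<lambda>n. prob (A n))"
  proof (rule summable_comparison_test_ev)
    show "eventually (\<lambda>n. norm (prob (A n)) \<le> 1 / real n ^ 2) sequentially"
      using ev_good by eventually_elim (simp add: Ap)
    show "summable (\<lambda>n. 1 / real n ^ 2)"
      using inverse_power_summable[of 2, where 'a=real] by (simp add: inverse_eq_divide)
  qed
  then have "AE \<omega> in M. eventually (\<lambda>n. \<omega> \<in> space M - A n) sequentially"
    by (intro borel_cantelli_AE1 Am) (auto simp: emeasure_eq_measure)
  then have "AE \<omega> in M. eventually (\<lambda>n. \<forall>u\<in>S.
    c1 / 8 * real n * \<epsilon> n ^ ?d \<le> card {i\<in>{1..n}. x i \<omega> \<in> ball u (r * \<epsilon> n)}) sequentially"
  proof eventually_elim
    case (elim \<omega>)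
    then show ?case using ev_good
    proof eventually_elim
      case (elim n)
      show ?case
      proof
        fix u assume u: "u \<in> S"
        obtain v where v: "v \<in> T n" "dist u v < t n" using T(4) elim u by blast
        \<comment> \<open>Radius \<open>t n\<close> at a net point closer than \<open>t n\<close>
          fits into radius \<open>2 * t n\<close>, so the count passes from the net to every
          \<open>u\<close>.\<close>
        have "ball v (t n) \<subseteq> ball u (r * \<epsilon> n)"
        proof
          fix z assume "z \<in> ball v (t n)"
          then show "z \<in> ball u (r * \<epsilon> n)" using v(2) dist_triangle[of u z v] by (simp add: t_def)
        qed
        then have sub: "{i\<in>J n. x i \<omega> \<in> ball v (t n)} \<subseteq> {i\<in>{1..n}. x i \<omega> \<in> ball u (r * \<epsilon> n)}"
          by (auto simp: J_def)
        have "c1 / 8 * real n * \<epsilon> n ^ ?d = q n * (real n / 2) / 4" by (simp add: q_def)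
        also have "\<dots> \<le> q n * card (J n) / 4"
          using J gn elim by (intro divide_right_mono mult_left_mono) (auto intro: less_imp_le)
        also have "\<dots> \<le> card {i\<in>J n. x i \<omega> \<in> ball v (t n)}"
          using elim v(1) by (auto simp: A_def E_def)
        also have "\<dots> \<le> card {i\<in>{1..n}. x i \<omega> \<in> ball u (r * \<epsilon> n)}"
          using sub by (intro of_nat_mono card_mono) auto
        finally show "c1 / 8 * real n * \<epsilon> n ^ ?d \<le> card {i\<in>{1..n}. x i \<omega> \<in> ball u (r * \<epsilon> n)}" .
      qed
    qed
  qed
  then show ?thesis using c1 by (intro exI[of _ "c1 / 8"]) auto
qed

section \<open>Oscillation and graph energy\<close>

text \<open>Cut the curve into pieces of parameter length at most \<open>h\<close> and replace each
  cut point by a sample within \<delta>. Consecutive samples are then closer than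
  \<open>h + 2 * \<delta>\<close>, and the differences telescope.\<close>

lemma joined_chain_bound:
  fixes q :: "'i \<Rightarrow> 'a::euclidean_space" and f :: "'a \<Rightarrow> real"
  assumes joined: "joined S l (q i) (q j)" and ij: "i \<in> I" "j \<in> I"
    and dense: "\<And>u. u \<in> S \<Longrightarrow> \<exists>k\<in>I. dist (q k) u < \<delta>" and h: "h > 0" "\<delta> > 0" and b: "b \<ge> 0"
    and step: "\<And>k k'. k \<in> I \<Longrightarrow> k' \<in> I \<Longrightarrow> dist (q k) (q k') < h + 2 * \<delta> \<Longrightarrow> \<bar>f (q k) - f (q k')\<bar> \<le> b"
  shows "\<bar>f (q i) - f (q j)\<bar> \<le> (l / h + 2) * b"
proof -
  obtain \<gamma> where g: "1-lipschitz_on {0..l} \<gamma>" "\<gamma> 0 = q i" "\<gamma> l = q j" "\<gamma> ` {0..l} \<subseteq> S" and l: "0 \<le> l"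
    using joined unfolding joined_def by blast
  \<comment> \<open>The extra 1 keeps \<open>m\<close> positive when \<open>l = 0\<close>; with the
    rounding it accounts for the \<open>+ 2\<close> in the bound.\<close>
  define m where "m = nat \<lceil>l / h\<rceil> + 1"
  have lh: "0 \<le> l / h" using l h by simp
  have m: "0 < m" "l / h \<le> real m" "real m \<le> l / h + 2" using lh by (auto simp: m_def) linarith+
  define \<tau> where "\<tau> s = real s * l / real m" for s
  have \<tau>: "\<tau> s \<in> {0..l}" if "s \<le> m" for s
    using that l m(1) mult_right_mono[of "real s" "real m" l] by (auto simp: \<tau>_def field_simps)
  have "\<exists>k\<in>I. dist (q k) (\<gamma> (\<tau> s)) < \<delta>" if "s \<le> m" for s
    using \<tau>[OF that] g(4) by (intro dense) blast
  then obtain v where v: "\<And>s. s \<le> m \<Longrightarrow> v s \<in> I" "\<And>s. s \<le> m \<Longrightarrow> dist (q (v s)) (\<gamma> (\<tau> s)) < \<delta>"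
    by metis
  \<comment> \<open>The endpoints of the curve are samples themselves, so the chain starts and ends
    exactly at \<open>i\<close> and \<open>j\<close>.\<close>
  define w where "w s = (if s = 0 then i else if s = m then j else v s)" for s
  have w: "w s \<in> I" "dist (q (w s)) (\<gamma> (\<tau> s)) < \<delta>" if "s \<le> m" for s
    using v that ij g(2,3) h m(1) by (auto simp: w_def \<tau>_def)
  have le: "\<bar>f (q (w (Suc s))) - f (q (w s))\<bar> \<le> b" if s: "s < m" for s
  proof (rule step)
    show "w (Suc s) \<in> I" "w s \<in> I" using w(1) s by auto
    have "dist (\<gamma> (\<tau> (Suc s))) (\<gamma> (\<tau> s)) \<le> 1 * dist (\<tau> (Suc s)) (\<tau> s)"
      using \<tau> s by (intro lipschitz_onD[OF g(1)]) auto
    also have "\<tau> (Suc s) - \<tau> s = l / real m" by (simp add: \<tau>_def distrib_right add_divide_distrib)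
    then have "1 * dist (\<tau> (Suc s)) (\<tau> s) = l / real m" using l by (simp add: dist_real_def)
    also have "\<dots> \<le> h" using m h by (simp add: field_simps)
    finally have "dist (\<gamma> (\<tau> (Suc s))) (\<gamma> (\<tau> s)) \<le> h" .
    moreover have "dist (q (w (Suc s))) (q (w s)) \<le> dist (q (w (Suc s))) (\<gamma> (\<tau> (Suc s)))
        + dist (\<gamma> (\<tau> (Suc s))) (\<gamma> (\<tau> s)) + dist (\<gamma> (\<tau> s)) (q (w s))"
      using dist_triangle[of "q (w (Suc s))" "q (w s)" "\<gamma> (\<tau> (Suc s))"]
        dist_triangle[of "\<gamma> (\<tau> (Suc s))" "q (w s)" "\<gamma> (\<tau> s)"] by linarith
    ultimately show "dist (q (w (Suc s))) (q (w s)) < h + 2 * \<delta>"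
      using w(2)[of s] w(2)[of "Suc s"] s by (simp add: dist_commute)
  qed
  have "\<bar>f (q (w m)) - f (q (w 0))\<bar> = \<bar>\<Sum>s<m. f (q (w (Suc s))) - f (q (w s))\<bar>"
    using sum_lessThan_telescope[of "\<lambda>s. f (q (w s))" m] by simp
  also have "\<dots> \<le> (\<Sum>s<m. \<bar>f (q (w (Suc s))) - f (q (w s))\<bar>)" by (rule sum_abs)
  also have "\<dots> \<le> real m * b" using le sum_bounded_above[of "{..<m}" _ b] by simp
  also have "\<dots> \<le> (l / h + 2) * b" using m(3) b by (rule mult_right_mono)
  finally show ?thesis using m(1) by (simp add: w_def abs_minus_commute)
qed

section \<open>Differences and oscillation bounded by the energy\<close>

lemma powr_sum_le:
  fixes a b p :: real
  assumes "a \<ge> 0" "b \<ge> 0" "p \<ge> 0"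
  shows "(a + b) powr p \<le> 2 powr p * (a powr p + b powr p)"
proof -
  have "(a + b) powr p \<le> (2 * max a b) powr p" using assms by (intro powr_mono2) auto
  also have "\<dots> = 2 powr p * max a b powr p" using assms by (simp add: powr_mult)
  also have "\<dots> \<le> 2 powr p * (a powr p + b powr p)" by (intro mult_left_mono) (auto simp: max_def)
  finally show ?thesis .
qed

text \<open>Averaging \<open>\<bar>f i - f j\<bar> \<le> \<bar>f i - f k\<bar> + \<bar>f k - f j\<bar>\<close> over the common neighbours \<open>k\<close> gains the
  factor \<open>n \<epsilon>\<^sup>d\<close> over the bound by a single edge.\<close>

lemma nearby_difference_le_energy:
  fixes q :: "nat \<Rightarrow> 'a::euclidean_space" and f :: "'a \<Rightarrow> real"
  assumes p: "p > 1" and e: "e > 0" and n: "n \<ge> 1"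
    and eta: "\<And>t. t \<ge> 0 \<Longrightarrow> \<eta> t \<ge> 0" "m > 0" "\<And>t. 0 \<le> t \<Longrightarrow> t \<le> r \<Longrightarrow> m \<le> \<eta> t"
    and c: "c > 0" "c * real n * e ^ DIM('a) \<le> card {k\<in>{1..n}. q k \<in> ball (q i) (r * e / 2)}"
    and ij: "i \<in> {1..n}" "j \<in> {1..n}" "dist (q i) (q j) \<le> r * e / 2"
  shows "\<bar>f (q i) - f (q j)\<bar> powr p
    \<le> 2 powr (p + 1) / (m * c) * (real n * e powr p * graph_energy \<eta> p e q n f)"
proof -
  let ?d = "DIM('a)" and ?I = "{1..n}"
  define W where "W k l = eta_scaled ?d \<eta> e (norm (q k - q l)) * \<bar>f (q k) - f (q l)\<bar> powr p" for k l
  define S where "S = (\<Sum>k\<in>?I. \<Sum>l\<in>?I. W k l)"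
  \<comment> \<open>Half the radius \<open>r * e\<close>: both \<open>k\<close> and \<open>j\<close>
    lie within it of \<open>i\<close>, so the edges from \<open>k\<close> to \<open>i\<close> and
    from \<open>k\<close> to \<open>j\<close> have length at most \<open>r * e\<close>, where the
    kernel is at least \<open>m\<close>.\<close>
  define B where "B = {k\<in>?I. q k \<in> ball (q i) (r * e / 2)}"
  let ?D = "\<bar>f (q i) - f (q j)\<bar> powr p"
  have W0: "W k l \<ge> 0" for k l
    using eta(1)[of "norm (q k - q l) / e"] e by (simp add: W_def eta_scaled_def)
  have edge: "\<bar>f (q k) - f (q l)\<bar> powr p \<le> e ^ ?d / m * W k l" if "dist (q k) (q l) \<le> r * e" for k l
  proof -
    have "m \<le> \<eta> (norm (q k - q l) / e)"
      using that e by (intro eta(3)) (auto simp: dist_norm field_simps)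
    then have "m * \<bar>f (q k) - f (q l)\<bar> powr p \<le> \<eta> (norm (q k - q l) / e) * \<bar>f (q k) - f (q l)\<bar> powr p"
      by (intro mult_right_mono) auto
    then show ?thesis using e eta(2) by (simp add: W_def eta_scaled_def field_simps)
  qed
  \<comment> \<open>The averages run over part of one row and part of one column of the nonnegative
    double sum, so each is at most the whole sum.\<close>
  have row: "(\<Sum>k\<in>B. W i k) \<le> S"
  proof -
    have "(\<Sum>k\<in>B. W i k) \<le> (\<Sum>k\<in>?I. W i k)" using W0 by (intro sum_mono2) (auto simp: B_def)
    also have "\<dots> \<le> S" unfolding S_def using W0 ij
      by (intro member_le_sum[of i ?I "\<lambda>k. \<Sum>l\<in>?I. W k l"]) (auto intro: sum_nonneg)
    finally show ?thesis .
  qed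
  have col: "(\<Sum>k\<in>B. W k j) \<le> S"
  proof -
    have "(\<Sum>k\<in>B. W k j) \<le> (\<Sum>k\<in>?I. W k j)" using W0 by (intro sum_mono2) (auto simp: B_def)
    also have "\<dots> \<le> S" unfolding S_def using W0 ij
      by (intro sum_mono member_le_sum[of j ?I]) auto
    finally show ?thesis .
  qed
  have "c * real n * e ^ ?d * ?D \<le> card B * ?D"
    using c by (intro mult_right_mono) (auto simp: B_def)
  also have "\<dots> = (\<Sum>k\<in>B. ?D)" by simp
  also have "\<dots> \<le> (\<Sum>k\<in>B. 2 powr p * (e ^ ?d / m * W i k + e ^ ?d / m * W k j))"
  proof (intro sum_mono)
    fix k assume "k \<in> B"
    then have k: "dist (q i) (q k) < r * e / 2" by (simp add: B_def)
    have "?D \<le> (\<bar>f (q i) - f (q k)\<bar> + \<bar>f (q k) - f (q j)\<bar>) powr p"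
      using p by (intro powr_mono2) auto
    also have "\<dots> \<le> 2 powr p * (\<bar>f (q i) - f (q k)\<bar> powr p + \<bar>f (q k) - f (q j)\<bar> powr p)"
      using p by (intro powr_sum_le) auto
    also have "\<dots> \<le> 2 powr p * (e ^ ?d / m * W i k + e ^ ?d / m * W k j)"
    proof (intro mult_left_mono add_mono edge)
      show "dist (q i) (q k) \<le> r * e" using k zero_le_dist[of "q i" "q k"] by linarith
      show "dist (q k) (q j) \<le> r * e" using k ij(3) dist_triangle3[of "q k" "q j" "q i"] by linarith
    qed simp
    finally show "?D \<le> 2 powr p * (e ^ ?d / m * W i k + e ^ ?d / m * W k j)" .
  qed
  also have "\<dots> = 2 powr p * (e ^ ?d / m * ((\<Sum>k\<in>B. W i k) + (\<Sum>k\<in>B. W k j)))"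
    by (simp only: sum_distrib_left[symmetric] distrib_left[symmetric] sum.distrib)
  also have "\<dots> \<le> 2 powr p * (e ^ ?d / m * (S + S))"
    using e eta(2) row col by (intro mult_left_mono add_mono) auto
  also have "\<dots> = e ^ ?d * (2 powr (p + 1) / m * S)" by (simp add: powr_add field_simps)
  \<comment> \<open>The \<open>e ^ DIM('a)\<close> from the kernel scaling cancels against the one
    in the number of neighbours.\<close>
  finally have "e ^ ?d * (c * real n * ?D) \<le> e ^ ?d * (2 powr (p + 1) / m * S)"
    by (simp add: mult_ac)
  then have "c * real n * ?D \<le> 2 powr (p + 1) / m * S"
    by (rule mult_left_le_imp_le) (use e in simp)
  moreover have "c * real n > 0" using c n by simp
  ultimately have "?D \<le> 2 powr (p + 1) / m * S / (c * real n)"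
    by (simp only: pos_le_divide_eq mult.commute[of ?D])
  also have "\<dots> = 2 powr (p + 1) / (m * c) * (S / real n)" by simp
  also have "S / real n = real n * e powr p * graph_energy \<eta> p e q n f"
  proof -
    have "graph_energy \<eta> p e q n f = S / (e powr p * (real n)\<^sup>2)"
      by (simp add: graph_energy_def S_def W_def)
    then show ?thesis using e n by (simp add: power2_eq_square)
  qed
  finally show ?thesis .
qed

text \<open>Hops come from the chain bound with \<open>h = r * e / 4\<close> and \<delta> =
  \<open>r * e / 8\<close>, so their length stays below \<open>r * e / 2\<close>, the range of the
  averaging estimate. The statement is deterministic, so any null set is independent of
  \<open>f\<close> and \<alpha>.\<close>

lemma graph_osc_le_energy:
  fixes q :: "nat \<Rightarrow> 'a::euclidean_space" and f :: "'a \<Rightarrow> real"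
  assumes p: "p > 1" and e: "e > 0"
    and eta: "\<And>t. t \<ge> 0 \<Longrightarrow> \<eta> t \<ge> 0" "m > 0" "r > 0" "\<And>t. 0 \<le> t \<Longrightarrow> t \<le> r \<Longrightarrow> m \<le> \<eta> t"
    and q: "\<And>i. i \<in> {1..n} \<Longrightarrow> q i \<in> S"
    and C: "C \<ge> 0" "\<And>u v. u \<in> S \<Longrightarrow> v \<in> S \<Longrightarrow> joined S (C * dist u v) u v"
    and c: "c > 0" "\<And>u. u \<in> S \<Longrightarrow> c * real n * e ^ DIM('a) \<le> card {k\<in>{1..n}. q k \<in> ball u (r / 8 * e)}"
    and \<alpha>: "\<alpha>0 > 0" "\<alpha> \<ge> \<alpha>0" and k: "k \<in> {1..n}"
  shows "graph_osc q n (\<alpha> * e) f (q k) powr p \<le> (8 * C / r + 2 / \<alpha>0) powr p * (2 powr (p + 1) / (m * c))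
    * \<alpha> powr p * real n * e powr p * graph_energy \<eta> p e q n f"
proof -
  let ?I = "{1..n}"
  have n: "n \<ge> 1" using k by simp
  define G where "G = 2 powr (p + 1) / (m * c) * (real n * e powr p * graph_energy \<eta> p e q n f)"
  have re: "r * e > 0" using eta(3) e by simp
  have "graph_energy \<eta> p e q n f \<ge> 0"
    unfolding graph_energy_def eta_scaled_def using e
    by (intro mult_nonneg_nonneg sum_nonneg divide_nonneg_nonneg eta(1)) auto
  then have G: "G \<ge> 0" using eta(2) c(1) by (simp add: G_def)
  have step: "\<bar>f (q i) - f (q j)\<bar> \<le> G powr (1 / p)"
    if ij: "i \<in> ?I" "j \<in> ?I" "dist (q i) (q j) < r * e / 4 + 2 * (r * e / 8)" for i j
  proof -
    \<comment> \<open>The count in the ball of radius \<open>r * e / 8\<close> serves twice: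
      enlarged, it supplies common neighbours here; below, its positivity supplies the chain
      points.\<close>
    have "c * real n * e ^ DIM('a) \<le> card {k\<in>?I. q k \<in> ball (q i) (r / 8 * e)}"
      using c(2) q ij by blast
    also have "\<dots> \<le> card {k\<in>?I. q k \<in> ball (q i) (r * e / 2)}"
      using re by (intro of_nat_mono card_mono) auto
    finally have "\<bar>f (q i) - f (q j)\<bar> powr p \<le> G"
      unfolding G_def using ij(3)[THEN less_imp_le]
      by (intro nearby_difference_le_energy[OF p e n eta(1,2,4) c(1) _ ij(1,2)]) (auto simp: mult.commute)
    then have "(\<bar>f (q i) - f (q j)\<bar> powr p) powr (1 / p) \<le> G powr (1 / p)"
      using p by (intro powr_mono2) auto
    then show ?thesis using p by (simp add: powr_powr)
  qed
  have dense: "\<exists>l\<in>?I. dist (q l) u < r * e / 8" if "u \<in> S" for u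
  proof -
    have "0 < c * real n * e ^ DIM('a)" using c(1) n e by simp
    then have "0 < card {k\<in>?I. q k \<in> ball u (r / 8 * e)}" using c(2)[OF that] by linarith
    then show ?thesis by (auto simp: card_gt_0_iff dist_commute)
  qed
  define X where "X = ball (q k) (\<alpha> * e) \<inter> sample_set q n"
  have X: "finite (f ` X)" "f ` X \<noteq> {}"
  proof -
    have "\<alpha> * e > 0" using \<alpha> e by simp
    then have "q k \<in> X" using k by (simp add: X_def sample_set_def)
    then show "f ` X \<noteq> {}" by blast
  qed (simp add: X_def sample_set_def)
  obtain u v where uv: "u \<in> X" "v \<in> X" "Max (f ` X) = f u" "Min (f ` X) = f v"
    using Max_in[OF X] Min_in[OF X] by blast
  obtain i j where ij: "i \<in> ?I" "j \<in> ?I" "u = q i" "v = q j"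
    using uv by (auto simp: X_def sample_set_def)
  have duv: "dist u v \<le> 2 * (\<alpha> * e)"
    using uv dist_triangle3[of u v "q k"] by (auto simp: X_def)
  have osc: "graph_osc q n (\<alpha> * e) f (q k) = f u - f v"
    by (simp add: graph_osc_def uv flip: X_def)
  have osc0: "0 \<le> f u - f v" using Max_ge[OF X(1)] uv by (metis diff_ge_0_iff_ge imageI)
  have "\<bar>f (q i) - f (q j)\<bar> \<le> (C * dist (q i) (q j) / (r * e / 4) + 2) * G powr (1 / p)"
    by (rule joined_chain_bound[where I = ?I and S = S and \<delta> = "r * e / 8"])
       (use q ij re C(2) dense step in auto)
  \<comment> \<open>The number of hops is affine in \<alpha>; the lower bound
    \<open>\<alpha>0\<close> turns the constant 2 into a multiple of \<alpha>. The factor 8 is the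
    diameter factor 2 divided by 1/4.\<close>
  also have "\<dots> \<le> ((8 * C / r + 2 / \<alpha>0) * \<alpha>) * G powr (1 / p)"
  proof (intro mult_right_mono)
    have "C * dist (q i) (q j) / (r * e / 4) \<le> C * (2 * (\<alpha> * e)) / (r * e / 4)"
      using duv ij C(1) re by (intro divide_right_mono mult_left_mono) auto
    also have "\<dots> = 8 * C / r * \<alpha>" using e eta(3) by (simp add: field_simps)
    finally have "C * dist (q i) (q j) / (r * e / 4) \<le> 8 * C / r * \<alpha>" .
    moreover have "2 \<le> 2 / \<alpha>0 * \<alpha>" using \<alpha> by (simp add: field_simps)
    ultimately show "C * dist (q i) (q j) / (r * e / 4) + 2 \<le> (8 * C / r + 2 / \<alpha>0) * \<alpha>"
      unfolding distrib_right by linarith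
  qed simp
  finally have "(f u - f v) powr p \<le> ((8 * C / r + 2 / \<alpha>0) * \<alpha> * G powr (1 / p)) powr p"
    using ij osc0 p by (intro powr_mono2) auto
  also have "\<dots> = (8 * C / r + 2 / \<alpha>0) powr p * \<alpha> powr p * G"
    using C(1) eta(3) \<alpha> G p by (simp add: powr_mult powr_powr)
  finally show ?thesis unfolding osc G_def by (simp add: mult_ac)
qed

section \<open>Choice of constants and the almost sure statement\<close>

theorem lemma4p1:
  fixes \<Omega> :: "'a::euclidean_space set"
    and \<mu> :: "'a measure" and \<rho> :: "'a \<Rightarrow> real"
    and N :: nat and a :: "nat \<Rightarrow> 'a" and y :: "nat \<Rightarrow> real"
    and M :: "'w measure" and x :: "nat \<Rightarrow> 'w \<Rightarrow> 'a"
    and \<epsilon> :: "nat \<Rightarrow> real" and \<eta> :: "real \<Rightarrow> real" and e1 :: 'a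
    and p \<alpha>0 :: real
  assumes p: "p > 1"
    and Omega: "open \<Omega>" "connected \<Omega>" "bounded \<Omega>" "lipschitz_boundary \<Omega>"
    and mu: "prob_space \<mu>" "\<mu> = density lborel (\<lambda>u. ennreal (indicator \<Omega> u * \<rho> u))"
    and rho: "continuous_on \<Omega> \<rho>" "\<exists>c>0. \<exists>C>0. \<forall>u\<in>\<Omega>. c \<le> \<rho> u \<and> \<rho> u \<le> C"
    and N: "N \<ge> 1"
    and labelled: "\<forall>i\<in>{1..N}. (a i, y i) \<in> \<Omega> \<times> (UNIV :: real set)" "inj_on a {1..N}"
    and M: "prob_space M"
    and x_labelled: "\<forall>i\<in>{1..N}. \<forall>\<omega>\<in>space M. x i \<omega> = a i"
    and x_measurable: "\<forall>i>N. x i \<in> borel_measurable M"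
    and x_distr: "\<forall>i>N. distr M borel (x i) = \<mu>"
    and x_indep: "prob_space.indep_vars M (\<lambda>_. borel) x {N<..}"
    and eps: "\<forall>n\<ge>1. \<epsilon> n > 0" "\<epsilon> \<longlonglongrightarrow> 0"
      "filterlim (\<lambda>n. \<epsilon> n / conn_scale DIM('a) n) at_top sequentially"
    and eta: "\<forall>t\<ge>0. \<eta> t \<ge> 0" "antimono_on {0..} \<eta>" "\<eta> 0 > 0" "continuous (at 0 within {0..}) \<eta>"
    and sigma: "e1 \<in> Basis" "sigma_eta \<eta> p e1 < \<infinity>"
    and alpha0: "\<alpha>0 > 0"
  shows "AE \<omega> in M. \<exists>n0>0. \<exists>C>0. \<forall>\<alpha>\<ge>\<alpha>0. \<forall>n\<ge>n0. \<forall>f :: 'a \<Rightarrow> real. \<forall>k\<in>{1..n}.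
    (graph_osc (\<lambda>i. x i \<omega>) n (\<alpha> * \<epsilon> n) f (x k \<omega>)) powr p
      \<le> C * \<alpha> powr p * real n * \<epsilon> n powr p * graph_energy \<eta> p (\<epsilon> n) (\<lambda>i. x i \<omega>) n f"
proof -
  interpret prob_space M by fact
  let ?d = "DIM('a)"
  obtain c0 where c0: "c0 > 0" "\<And>u. u \<in> \<Omega> \<Longrightarrow> c0 \<le> \<rho> u" using rho(2) by blast
  obtain C where C: "C \<ge> 0" "\<And>u v. u \<in> \<Omega> \<Longrightarrow> v \<in> \<Omega> \<Longrightarrow> joined \<Omega> (C * dist u v) u v"
    using lipschitz_domain_quasiconvex_and_cone(1)[OF Omega] by blast
  obtain \<kappa> R where \<kappa>: "\<kappa> > 0" "R > 0"
    "\<And>u t. u \<in> \<Omega> \<Longrightarrow> 0 < t \<Longrightarrow> t \<le> R \<Longrightarrow> \<exists>w. ball w (\<kappa> * t) \<subseteq> \<Omega> \<inter> ball u t"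
    using lipschitz_domain_quasiconvex_and_cone(2)[OF Omega] by blast
  define c\<^sub>\<mu> where "c\<^sub>\<mu> = c0 * unit_ball_vol (real ?d) * \<kappa> ^ ?d"
  have c\<mu>: "c\<^sub>\<mu> > 0" using c0 \<kappa> by (simp add: c\<^sub>\<mu>_def)
  have ball_mass: "c\<^sub>\<mu> * t ^ ?d \<le> measure \<mu> (ball u t)" if ut: "u \<in> \<Omega>" "0 < t" "t \<le> R" for u t
  proof -
    obtain w where "ball w (\<kappa> * t) \<subseteq> \<Omega> \<inter> ball u t" using \<kappa>(3)[OF ut] by blast
    then show ?thesis
      using measure_ball_lower_bound[OF mu Omega(1) rho(1) c0 \<kappa>(1) ut(2)] by (simp add: c\<^sub>\<mu>_def)
  qed
  have sets_\<mu>: "sets \<mu> = sets borel" by (subst mu(2)) simp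

  \<comment> \<open>Continuity at 0 keeps the kernel above half of \<open>\<eta> 0\<close> on an
    interval; \<open>r\<close> is fixed first because the sampling radius
    \<open>r / 8 * \<epsilon> n\<close> depends on it.\<close>
  obtain r m where rm: "r > 0" "m > 0" "\<And>t. 0 \<le> t \<Longrightarrow> t \<le> r \<Longrightarrow> m \<le> \<eta> t"
  proof -
    obtain \<delta> where \<delta>: "\<delta> > 0" "\<And>t. t \<in> {0..} \<Longrightarrow> dist t 0 < \<delta> \<Longrightarrow> dist (\<eta> t) (\<eta> 0) < \<eta> 0 / 2"
      using eta(4) half_gt_zero[OF eta(3)] unfolding continuous_within_eps_delta by blast
    have "\<eta> 0 / 2 \<le> \<eta> t" if "0 \<le> t" "t \<le> \<delta> / 2" for t
    proof -
      have "dist (\<eta> t) (\<eta> 0) < \<eta> 0 / 2" using that \<delta>(1) by (intro \<delta>(2)) auto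
      then show ?thesis unfolding dist_real_def by linarith
    qed
    then show thesis using \<delta>(1) eta(3) by (intro that[of "\<delta> / 2" "\<eta> 0 / 2"]) auto
  qed

  obtain c where c: "c > 0" and many: "AE \<omega> in M. eventually (\<lambda>n. \<forall>u\<in>\<Omega>.
    c * real n * \<epsilon> n ^ ?d \<le> card {i\<in>{1..n}. x i \<omega> \<in> ball u (r / 8 * \<epsilon> n)}) sequentially"
  proof -
    have "\<exists>c>0. AE \<omega> in M. eventually (\<lambda>n. \<forall>u\<in>\<Omega>.
      c * real n * \<epsilon> n ^ ?d \<le> card {i\<in>{1..n}. x i \<omega> \<in> ball u (r / 8 * \<epsilon> n)}) sequentially"
      using x_measurable x_distr rm(1)
      by (intro eventually_many_samples_in_balls[OF M mu(1) sets_\<mu> _ _ x_indep c\<mu> \<kappa>(2) ball_mass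
            _ eps(1,2) conn_scale_growth[OF _ eps(3)]]) (auto simp: Suc_leI)
    then show thesis using that by blast
  qed

  \<comment> \<open>Curves are available only between points of the domain, so all samples must lie
    in it; countably many null sets are discarded.\<close>
  have "AE \<omega> in M. x i \<omega> \<in> \<Omega>" if i: "i \<ge> 1" for i
  proof (cases "i \<le> N")
    case True
    then show ?thesis using x_labelled labelled(1) i by (intro AE_I2) auto
  next
    case False
    have [measurable]: "(\<lambda>u. indicator \<Omega> u * \<rho> u) \<in> borel_measurable borel"
      using borel_measurable_continuous_on_indicator[OF _ rho(1)] Omega(1) by simp
    have "AE u in \<mu>. u \<in> \<Omega>" 
      by (subst mu(2), subst AE_density, measurable) (auto simp: indicator_def)
    then have "AE u in distr M borel (x i). u \<in> \<Omega>" using x_distr False by (metis linorder_not_le)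
    then show ?thesis using x_measurable False Omega(1)
      by (subst (asm) AE_distr_iff) (auto simp: not_le)
  qed
  then have inside: "AE \<omega> in M. \<forall>i. i \<ge> 1 \<longrightarrow> x i \<omega> \<in> \<Omega>"
    by (simp add: AE_all_countable)

  \<comment> \<open>Every ingredient is fixed independently of \<omega>, so \<open>K\<close> is
    deterministic and only the threshold \<open>n1\<close> is random.\<close>
  define K where "K = (8 * C / r + 2 / \<alpha>0) powr p * (2 powr (p + 1) / (m * c))"
  have K: "K > 0"
  proof -
    have "0 < 8 * C / r + 2 / \<alpha>0" using C(1) rm(1) alpha0 by (intro add_nonneg_pos) auto
    then show ?thesis using rm(2) c by (simp add: K_def)
  qed
  from many inside show ?thesis
  proof eventually_elim
    case (elim \<omega>)
    then obtain n1 where n1: "\<And>n u. n \<ge> n1 \<Longrightarrow> u \<in> \<Omega> \<Longrightarrow>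
      c * real n * \<epsilon> n ^ ?d \<le> card {i\<in>{1..n}. x i \<omega> \<in> ball u (r / 8 * \<epsilon> n)}"
      unfolding eventually_sequentially by blast
    have "graph_osc (\<lambda>i. x i \<omega>) n (\<alpha> * \<epsilon> n) f (x k \<omega>) powr p
      \<le> K * \<alpha> powr p * real n * \<epsilon> n powr p * graph_energy \<eta> p (\<epsilon> n) (\<lambda>i. x i \<omega>) n f"
      if "\<alpha> \<ge> \<alpha>0" "n \<ge> max 1 n1" "k \<in> {1..n}" for \<alpha> n f k
      unfolding K_def
      by (rule graph_osc_le_energy[where S = \<Omega> and q = "\<lambda>i. x i \<omega>", OF p _ _ rm(2,1,3) _ C c n1 alpha0])
         (use that elim(2) eps(1) eta(1) in auto)
    \<comment> \<open>The maximum with 1 makes the threshold positive and ensures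
      \<open>\<epsilon> n > 0\<close>.\<close>
    then show ?case using K by (intro exI[of _ "max 1 n1"] conjI exI[of _ K]) auto
  qed
qed

end
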